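(* Let $a,b\in\mathbb{N}$ with $a\le b$, and suppose that $a+b$ is even. Write $\mathcal{C}_0=\mathcal{C}_0(a,b)$ and $\mathcal{C}_1=\mathcal{C}_1(a,b)$. Then $\mathcal{C}_1$ has dimension $\dim(\mathcal{C}_1)=\dim(\mathcal{C}_0)-1=a+b-2$. Moreover, the minimum distance of $\mathcal{C}_1$ is $d(\mathcal{C}_1)=2a$ if $1\le a<b$, and $d(\mathcal{C}_1)=2a-2$ if $1<a=b$. In special cases we have the following explicit description of $\mathcal{C}_1$. \begin{enumerate} \item[(1)] If $1=a=b$, then $\mathcal{C}_1=\{0\}$. \item[(2)] If $2=a=b$, then $\mathcal{C}_1=\left\{\begin{pmatrix}0&0\\0&0\end{pmatrix},\begin{pmatrix}0&1\\1&0\end{pmatrix},\begin{pmatrix}1&0\\0&1\end{pmatrix},\begin{pmatrix}1&1\\1&1\end{pmatrix}\right\}$. \item[(3)] If $a$ and $b$ are both odd, then $\mathcal{C}_1=\{\mathbf{v}\in\mathcal{C}_0 : \operatorname{wt}(\mathbf{v})\equiv 0\pmod 2\}$. \end{enumerate}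
   Context: $\mathbb{N}$ denotes the positive integers. For $a,b\in\mathbb{N}$ with $a\le b$, let $\mathcal{V}=\operatorname{Mat}(a,b,\mathbb{F}_2)$ be the $\mathbb{F}_2$-vector space of $a\times b$ matrices, with standard basis the elementary matrices $\mathbf{e}_{ij}$, $1\le i\le a$, $1\le j\le b$. Define $\mathbf{r}_i=\sum_{j=1}^b\mathbf{e}_{ij}$ ($1\le i\le a$) and $\mathbf{c}_j=\sum_{i=1}^a\mathbf{e}_{ij}$ ($1\le j\le b$). Let $\mathcal{C}_0(a,b)\le\mathcal{V}$ be the $\mathbb{F}_2$-span of $\{\mathbf{r}_1,\ldots,\mathbf{r}_a,\mathbf{c}_1,\ldots,\mathbf{c}_b\}$, and let $\mathcal{C}_1(a,b)\le\mathcal{V}$ be the $\mathbb{F}_2$-span of $\{\mathbf{r}_i+\mathbf{c}_j : 1\le i\le a,\ 1\le j\le b\}$. The weight $\operatorname{wt}(\mathbf{v})$ of $\mathbf{v}\in\mathcal{V}$ is its number of non-zero entries, and the minimum distance $d(\mathcal{C})$ of a subspace $\mathcal{C}\le\mathcal{V}$ is the minimum of $\operatorname{wt}(\mathbf{v})$ over non-zero $\mathbf{v}\in\mathcal{C}$. *)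

theory Defs
  imports "HOL-Library.Z2" "Jordan_Normal_Form.VS_Connect"
begin

text \<open>
  The field with two elements is the type \<open>bit\<close>. Rows and columns are numbered from 0, as usual for
  \<open>mat\<close>, so the index ranges \<open>1, ..., a\<close> and \<open>1, ..., b\<close> of the literature become \<open>{..<a}\<close> and
  \<open>{..<b}\<close>.
\<close>

abbreviation mat_space :: "nat \<Rightarrow> nat \<Rightarrow> (bit, bit mat) module" where
  "mat_space a b \<equiv> module_mat TYPE(bit) a b"

definition elem_mat :: "nat \<Rightarrow> nat \<Rightarrow> nat \<Rightarrow> nat \<Rightarrow> bit mat" where
  "elem_mat a b i j = mat a b (\<lambda>ij. if ij = (i, j) then 1 else 0)"

definition row_mat :: "nat \<Rightarrow> nat \<Rightarrow> nat \<Rightarrow> bit mat" where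
  "row_mat a b i = (\<Oplus>\<^bsub>mat_space a b\<^esub> j \<in> {..<b}. elem_mat a b i j)"

definition col_mat :: "nat \<Rightarrow> nat \<Rightarrow> nat \<Rightarrow> bit mat" where
  "col_mat a b j = (\<Oplus>\<^bsub>mat_space a b\<^esub> i \<in> {..<a}. elem_mat a b i j)"

definition code0 :: "nat \<Rightarrow> nat \<Rightarrow> bit mat set" where
  "code0 a b = LinearCombinations.module.span class_ring (mat_space a b) (row_mat a b ` {..<a} \<union> col_mat a b ` {..<b})"

definition code1 :: "nat \<Rightarrow> nat \<Rightarrow> bit mat set" where
  "code1 a b = LinearCombinations.module.span class_ring (mat_space a b)
     {row_mat a b i + col_mat a b j | i j. i < a \<and> j < b}"

definition code_dim :: "nat \<Rightarrow> nat \<Rightarrow> bit mat set \<Rightarrow> nat" where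
  "code_dim a b C = vectorspace.dim class_ring ((mat_space a b)\<lparr>carrier := C\<rparr>)"

definition weight :: "bit mat \<Rightarrow> nat" where
  "weight v = card {(i, j). i < dim_row v \<and> j < dim_col v \<and> v $$ (i, j) \<noteq> 0}"

text \<open>Only meaningful for codes with a non-zero element; otherwise \<open>Min\<close> is taken over the empty set.\<close>

definition min_distance :: "nat \<Rightarrow> nat \<Rightarrow> bit mat set \<Rightarrow> nat" where
  "min_distance a b C = Min (weight ` (C - {0\<^sub>m a b}))"

lemma index_finsum_mat:
  assumes "finite A" and "\<And>x. x \<in> A \<Longrightarrow> f x \<in> carrier_mat a b" and "i < a" "j < b"
  shows "finsum (mat_space a b) f A $$ (i, j) = (\<Sum>x\<in>A. f x $$ (i, j))"
    and "finsum (mat_space a b) f A \<in> carrier_mat a b"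
proof -
  interpret matrix_vs a b "TYPE(bit)" .
  have *: "finsum V f A \<in> carrier_mat a b \<and> finsum V f A $$ (i, j) = (\<Sum>x\<in>A. f x $$ (i, j))"
    using assms
  proof (induction A rule: finite_induct)
    case empty
    then show ?case by simp
  next
    case (insert x F)
    then have "finsum V f (insert x F) = f x + finsum V f F"
      by (subst finsum_insert) auto
    moreover have fx: "f x \<in> carrier_mat a b"
      and IH: "finsum V f F \<in> carrier_mat a b" "finsum V f F $$ (i, j) = (\<Sum>x\<in>F. f x $$ (i, j))"
      using insert by blast+
    moreover have "(f x + finsum V f F) $$ (i, j) = f x $$ (i, j) + finsum V f F $$ (i, j)"
      using carrier_matD[OF IH(1)] assms(3,4) by (intro index_add_mat(1)) auto
    ultimately show ?case using insert.hyps add_carrier_mat[OF IH(1)] by (simp add: comm_monoid_add_class.sum.insert)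
  qed
  show "finsum V f A $$ (i, j) = (\<Sum>x\<in>A. f x $$ (i, j))" "finsum V f A \<in> carrier_mat a b"
    using * by blast+
qed

lemma row_mat_index:
  assumes "k < a" "l < b"
  shows "row_mat a b i $$ (k, l) = (if k = i then 1 else 0)"
  using assms unfolding row_mat_def
  by (subst index_finsum_mat(1)) (auto simp: elem_mat_def)

lemma col_mat_index:
  assumes "k < a" "l < b"
  shows "col_mat a b j $$ (k, l) = (if l = j then 1 else 0)"
  using assms unfolding col_mat_def
  by (subst index_finsum_mat(1)) (auto simp: elem_mat_def)

end

theory Submission
  imports Defs
begin

text \<open>
  Every sum of rows \<open>S\<close> and columns \<open>T\<close> is the matrix whose entry at \<open>(i, j)\<close> is \<open>1\<close> exactly when one
  of \<open>i \<in> S\<close>, \<open>j \<in> T\<close> holds but not both; call it the cross of \<open>S\<close> and \<open>T\<close>. Crosses add by symmetric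
  differences, so \<open>\<C>\<^sub>0\<close> consists of all crosses, and \<open>\<C>\<^sub>1\<close> of those with \<open>card S + card T\<close> even: the
  generators have this parity and symmetric differences preserve it, while conversely a pair of rows
  or a pair of columns is a sum of two generators (\<open>code0_eq\<close>, \<open>code1_eq\<close>).

  Two pairs give the same cross only if they are equal or complementary, so normalising to
  \<open>0 \<notin> S\<close> makes the parametrisation injective. Complementing both sets changes
  \<open>card S + card T\<close> by an even amount because \<open>a + b\<close> is even, so this normalisation works inside
  \<open>\<C>\<^sub>1\<close> too. Counting normalised pairs gives \<open>2 ^ (a + b - 1)\<close> and
  \<open>2 ^ (a + b - 2)\<close> codewords, and over a field of two elements the number of vectors determines the
  dimension (\<open>card_carrier_eq_power_dim\<close>).

  With \<open>s = card S\<close>, \<open>s' = a - s\<close>, \<open>t = card T\<close>, \<open>t' = b - t\<close>, the cross has weight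
  \<open>s t' + s' t\<close>. If one of the four numbers vanishes, parity forces some other one to be at least
  \<open>2\<close>, and the weight is at least \<open>2 a\<close>. Otherwise \<open>(s - 1) (t' - 1) + (s' - 1) (t - 1) \<ge> 0\<close>
  says that the weight is at least \<open>a + b - 2\<close>, which is \<open>2 a - 2\<close> for \<open>a = b\<close> and at least \<open>2 a\<close>
  for \<open>a < b\<close>, as \<open>a\<close> and \<open>b\<close> have equal parity (\<open>even_cross_weight_bound\<close>). The sum of two
  columns and, for \<open>a = b\<close>, the sum of a row and a column attain these bounds.
\<close>

section \<open>Dimension by counting\<close>

text \<open>Coordinates with respect to a finite basis are a bijection onto the functions from the basis to
  the field. This turns the dimensions of both codes into a count of codewords.\<close>

lemma (in vectorspace) card_carrier_eq_power_dim:
  assumes "finite (carrier V)"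
  shows "card (carrier V) = card (carrier K) ^ dim"
proof -
  have "span (carrier V) = carrier V"
    using in_own_span[of "carrier V"] span_is_subset2[of "carrier V"] by blast
  then have fin_dim
    using assms unfolding fin_dim_def by blast
  then obtain B where B: "finite B" "basis B"
    using finite_basis_exists by blast
  then have BV: "B \<subseteq> carrier V"
    by (simp add: basis_def)
  have unique: "\<exists>!c. c \<in> B \<rightarrow>\<^sub>E carrier K \<and> lincomb c B = v" if "v \<in> carrier V" for v
    using basis_criterion[OF B(1) BV] B(2) that by blast
  have closed: "lincomb c B \<in> carrier V" if "c \<in> B \<rightarrow>\<^sub>E carrier K" for c
    using that BV by (intro lincomb_closed) (auto simp: PiE_def)
  have "bij_betw (\<lambda>c. lincomb c B) (B \<rightarrow>\<^sub>E carrier K) (carrier V)"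
  proof (rule bij_betw_imageI)
    show "inj_on (\<lambda>c. lincomb c B) (B \<rightarrow>\<^sub>E carrier K)"
    proof (rule inj_onI)
      fix c c' assume "c \<in> B \<rightarrow>\<^sub>E carrier K" "c' \<in> B \<rightarrow>\<^sub>E carrier K" "lincomb c B = lincomb c' B"
      then show "c = c'" using unique[OF closed[of c]] by metis
    qed
    show "(\<lambda>c. lincomb c B) ` (B \<rightarrow>\<^sub>E carrier K) = carrier V"
    proof
      show "(\<lambda>c. lincomb c B) ` (B \<rightarrow>\<^sub>E carrier K) \<subseteq> carrier V"
        using closed by blast
      show "carrier V \<subseteq> (\<lambda>c. lincomb c B) ` (B \<rightarrow>\<^sub>E carrier K)"
        using unique by blast
    qed
  qed
  then have "card (carrier V) = card (B \<rightarrow>\<^sub>E carrier K)"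
    by (simp add: bij_betw_same_card)
  also have "\<dots> = card (carrier K) ^ card B"
    using B(1) by (rule card_funcsetE)
  finally show ?thesis
    using dim_basis[OF B] by simp
qed

lemma UNIV_bit: "(UNIV :: bit set) = {0, 1}"
proof (rule UNIV_eq_I)
  show "x \<in> {0, 1}" for x :: bit
    by (cases "x = 0") simp_all
qed

lemma card_UNIV_bit: "card (UNIV :: bit set) = 2"
  unfolding UNIV_bit by (subst card_2_iff) auto

text \<open>A matrix is determined by the restriction of its entry function to the index range.\<close>

lemma finite_carrier_mat_bit: "finite (carrier_mat a b :: bit mat set)"
proof -
  have "carrier_mat a b \<subseteq> (\<lambda>f. mat a b f) ` (({..<a} \<times> {..<b}) \<rightarrow>\<^sub>E (UNIV :: bit set))"
  proof
    fix v :: "bit mat" assume "v \<in> carrier_mat a b"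
    then have "v = mat a b (restrict (\<lambda>ij. v $$ ij) ({..<a} \<times> {..<b}))"
      by (intro eq_matI) auto
    moreover have "restrict (\<lambda>ij. v $$ ij) ({..<a} \<times> {..<b}) \<in> ({..<a} \<times> {..<b}) \<rightarrow>\<^sub>E UNIV"
      by auto
    ultimately show "v \<in> (\<lambda>f. mat a b f) ` (({..<a} \<times> {..<b}) \<rightarrow>\<^sub>E UNIV)"
      by (metis imageI)
  qed
  moreover have "finite (({..<a} \<times> {..<b}) \<rightarrow>\<^sub>E (UNIV :: bit set))"
    by (intro finite_PiE) (auto simp: UNIV_bit)
  ultimately show ?thesis
    using finite_surj by blast
qed

lemma code_dim_eqI:
  assumes "submodule class_ring C (mat_space a b)" "card C = 2 ^ n"
  shows "code_dim a b C = n"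
proof -
  interpret matrix_vs a b "TYPE(bit)" .
  have "C \<subseteq> carrier_mat a b"
    using submodule.subset[OF assms(1)] by (simp add: matrix_vs_simps)
  then have fin: "finite C"
    using finite_carrier_mat_bit finite_subset by blast
  have "subspace class_ring C V"
    using assms(1) vectorspace_axioms by (simp add: subspace_def)
  then have vs: "vectorspace class_ring (vs C)"
    by (rule subspace_is_vs)
  have "card C = card (UNIV :: bit set) ^ vectorspace.dim class_ring (vs C)"
    using vectorspace.card_carrier_eq_power_dim[OF vs] fin by simp
  then have "(2::nat) ^ n = 2 ^ code_dim a b C"
    using assms(2) by (simp only: card_UNIV_bit code_dim_def)
  then show ?thesis by simp
qed

section \<open>Crosses\<close>

text \<open>The sum of the rows in \<open>S\<close> and the columns in \<open>T\<close>, written without any summation: over the field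
  of two elements only the parity of the number of summands that meet an entry matters.\<close>

definition cross_mat :: "nat \<Rightarrow> nat \<Rightarrow> nat set \<Rightarrow> nat set \<Rightarrow> bit mat" where
  "cross_mat a b S T = mat a b (\<lambda>(i, j). of_bool ((i \<in> S) \<noteq> (j \<in> T)))"

lemma cross_mat_carrier [simp]: "cross_mat a b S T \<in> carrier_mat a b"
  by (simp add: cross_mat_def)

lemma cross_mat_index [simp]:
  "i < a \<Longrightarrow> j < b \<Longrightarrow> cross_mat a b S T $$ (i, j) = of_bool ((i \<in> S) \<noteq> (j \<in> T))"
  by (simp add: cross_mat_def)

lemma cross_mat_dim [simp]: "dim_row (cross_mat a b S T) = a" "dim_col (cross_mat a b S T) = b"
  by (simp_all add: cross_mat_def)

lemma cross_mat_add:
  "cross_mat a b S T + cross_mat a b S' T' =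
    cross_mat a b (sym_diff S S') (sym_diff T T')"
  by (rule eq_matI) auto

lemma cross_mat_empty: "cross_mat a b {} {} = 0\<^sub>m a b"
  by (rule eq_matI) auto

text \<open>The sum of all rows equals the sum of all columns. This is the only linear relation among the
  rows and columns, and the reason why \<open>\<C>\<^sub>0\<close> has dimension \<open>a + b - 1\<close>.\<close>

lemma cross_mat_complement:
  "cross_mat a b ({..<a} - S) ({..<b} - T) = cross_mat a b S T"
  by (rule eq_matI) auto

lemma row_mat_eq_cross_mat: "row_mat a b i = cross_mat a b {i} {}"
proof (rule eq_matI)
  interpret matrix_vs a b "TYPE(bit)" .
  have "row_mat a b i \<in> carrier_mat a b"
    unfolding row_mat_def by (rule finsum_closed) (auto simp: elem_mat_def)
  then show "dim_row (row_mat a b i) = dim_row (cross_mat a b {i} {})"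
    "dim_col (row_mat a b i) = dim_col (cross_mat a b {i} {})" by auto
qed (auto simp: row_mat_index)

lemma col_mat_eq_cross_mat: "col_mat a b j = cross_mat a b {} {j}"
proof (rule eq_matI)
  interpret matrix_vs a b "TYPE(bit)" .
  have "col_mat a b j \<in> carrier_mat a b"
    unfolding col_mat_def by (rule finsum_closed) (auto simp: elem_mat_def)
  then show "dim_row (col_mat a b j) = dim_row (cross_mat a b {} {j})"
    "dim_col (col_mat a b j) = dim_col (cross_mat a b {} {j})" by auto
qed (auto simp: col_mat_index)

text \<open>The support is the disjoint union of \<open>S \<times> ({..<b} - T)\<close> and \<open>({..<a} - S) \<times> T\<close>.\<close>

lemma weight_cross_mat:
  assumes "S \<subseteq> {..<a}" "T \<subseteq> {..<b}"
  shows "weight (cross_mat a b S T) = card S * (b - card T) + (a - card S) * card T"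
proof -
  have fin: "finite S" "finite T"
    using assms finite_subset by blast+
  have "{(i, j). i < a \<and> j < b \<and> cross_mat a b S T $$ (i, j) \<noteq> 0} =
      S \<times> ({..<b} - T) \<union> ({..<a} - S) \<times> T"
    using assms by auto
  then have "weight (cross_mat a b S T) = card (S \<times> ({..<b} - T) \<union> ({..<a} - S) \<times> T)"
    by (simp add: weight_def)
  also have "\<dots> = card (S \<times> ({..<b} - T)) + card (({..<a} - S) \<times> T)"
    using fin by (intro card_Un_disjoint) auto
  finally show ?thesis
    using assms fin by (simp add: card_cartesian_product card_Diff_subset)
qed

section \<open>The two codes as sets of crosses\<close>

abbreviation cross_pairs :: "nat \<Rightarrow> nat \<Rightarrow> (nat set \<times> nat set) set" where
  "cross_pairs a b \<equiv> Pow {..<a} \<times> Pow {..<b}"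

lemma even_card_sym_diff:
  assumes "finite A" "finite B"
  shows "even (card (sym_diff A B)) \<longleftrightarrow> even (card A + card B)"
proof -
  have "card (sym_diff A B) = card (A - B) + card (B - A)"
    using assms by (intro card_Un_disjoint) auto
  moreover have "card A = card (A - B) + card (A \<inter> B)"
    using card_Diff_subset_Int[of A B] card_mono[of A "A \<inter> B"] assms by simp
  moreover have "card B = card (B - A) + card (A \<inter> B)"
    using card_Diff_subset_Int[of B A] card_mono[of B "A \<inter> B"] assms by (simp add: Int_commute)
  ultimately show ?thesis by presburger
qed

text \<open>Over the field of two elements, scalar multiples are \<open>0\<close> or the vector itself, so closure under
  addition is all that matters. The set \<open>P\<close> of pairs is the full set for \<open>\<C>\<^sub>0\<close> and the even part of it
  for \<open>\<C>\<^sub>1\<close>.\<close>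

lemma submodule_cross_mat_image:
  assumes "P \<subseteq> cross_pairs a b" "({}, {}) \<in> P"
    and "\<And>S T S' T'. (S, T) \<in> P \<Longrightarrow> (S', T') \<in> P \<Longrightarrow> (sym_diff S S', sym_diff T T') \<in> P"
  shows "submodule class_ring ((\<lambda>(S, T). cross_mat a b S T) ` P) (mat_space a b)"
proof -
  interpret matrix_vs a b "TYPE(bit)" .
  have zero: "0\<^sub>m a b \<in> (\<lambda>(S, T). cross_mat a b S T) ` P"
    using assms(2) cross_mat_empty[of a b] by force
  show ?thesis
  proof (unfold_locales, unfold matrix_vs_simps)
    show "(\<lambda>(S, T). cross_mat a b S T) ` P \<subseteq> carrier_mat a b"
      by auto
  next
    fix v w assume "v \<in> (\<lambda>(S, T). cross_mat a b S T) ` P" "w \<in> (\<lambda>(S, T). cross_mat a b S T) ` P"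
    then show "v + w \<in> (\<lambda>(S, T). cross_mat a b S T) ` P"
      using assms(3) by (force simp: cross_mat_add)
  next
    fix c :: bit and v
    assume v: "v \<in> (\<lambda>(S, T). cross_mat a b S T) ` P"
    show "c \<cdot>\<^sub>m v \<in> (\<lambda>(S, T). cross_mat a b S T) ` P"
    proof (cases "c = 0")
      case True
      have "c \<cdot>\<^sub>m v = 0\<^sub>m a b" using v True by (intro eq_matI) auto
      then show ?thesis using zero by simp
    next
      case False
      have "c \<cdot>\<^sub>m v = v" using False by (intro eq_matI) auto
      then show ?thesis using v by simp
    qed
  qed (use zero in auto)
qed

definition even_pairs :: "nat \<Rightarrow> nat \<Rightarrow> (nat set \<times> nat set) set" where
  "even_pairs a b = {(S, T) \<in> cross_pairs a b. even (card S + card T)}"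

lemma submodule_all_crosses:
  "submodule class_ring ((\<lambda>(S, T). cross_mat a b S T) ` cross_pairs a b) (mat_space a b)"
  by (rule submodule_cross_mat_image) auto

lemma submodule_even_crosses:
  "submodule class_ring ((\<lambda>(S, T). cross_mat a b S T) ` even_pairs a b) (mat_space a b)"
proof (rule submodule_cross_mat_image)
  fix S T S' T' assume "(S, T) \<in> even_pairs a b" "(S', T') \<in> even_pairs a b"
  moreover from this have "finite S" "finite T" "finite S'" "finite T'"
    by (auto simp: even_pairs_def intro: finite_subset)
  ultimately show "(sym_diff S S', sym_diff T T') \<in> even_pairs a b"
    using even_card_sym_diff[of S S'] even_card_sym_diff[of T T'] by (auto simp: even_pairs_def)
qed (auto simp: even_pairs_def)

lemma code0_eq: "code0 a b = (\<lambda>(S, T). cross_mat a b S T) ` cross_pairs a b"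
proof
  interpret matrix_vs a b "TYPE(bit)" .
  let ?G = "row_mat a b ` {..<a} \<union> col_mat a b ` {..<b}"
  have G: "?G \<subseteq> carrier_mat a b"
    by (auto simp: row_mat_eq_cross_mat col_mat_eq_cross_mat)
  have "?G \<subseteq> (\<lambda>(S, T). cross_mat a b S T) ` cross_pairs a b"
    by (force simp: row_mat_eq_cross_mat col_mat_eq_cross_mat)
  then show "code0 a b \<subseteq> (\<lambda>(S, T). cross_mat a b S T) ` cross_pairs a b"
    unfolding code0_def by (rule span_is_subset[OF _ submodule_all_crosses])
  have sub: "submodule class_ring (code0 a b) V"
    unfolding code0_def using G by (rule span_is_submodule)
  have add: "v + w \<in> code0 a b" if "v \<in> code0 a b" "w \<in> code0 a b" for v w
    using submodule.m_closed[OF sub that] by (simp add: matrix_vs_simps)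
  have gen: "?G \<subseteq> code0 a b"
    unfolding code0_def using G by (rule in_own_span)
  have empty: "cross_mat a b {} {} \<in> code0 a b"
    using submodule.zero_closed[OF sub] by (simp add: matrix_vs_simps cross_mat_empty)
  have rows: "cross_mat a b S {} \<in> code0 a b" if "finite S" "S \<subseteq> {..<a}" for S
    using that
  proof (induction S rule: finite_induct)
    case (insert i S)
    then have "cross_mat a b {i} {} + cross_mat a b S {} \<in> code0 a b"
      using gen by (intro add) (auto simp: row_mat_eq_cross_mat)
    then show ?case
      using insert.hyps by (simp add: cross_mat_add)
  qed (rule empty)
  have cols: "cross_mat a b {} T \<in> code0 a b" if "finite T" "T \<subseteq> {..<b}" for T
    using that
  proof (induction T rule: finite_induct)
    case (insert j T)
    then have "cross_mat a b {} {j} + cross_mat a b {} T \<in> code0 a b"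
      using gen by (intro add) (auto simp: col_mat_eq_cross_mat)
    then show ?case
      using insert.hyps by (simp add: cross_mat_add)
  qed (rule empty)
  show "(\<lambda>(S, T). cross_mat a b S T) ` cross_pairs a b \<subseteq> code0 a b"
  proof clarify
    fix S T assume ST: "S \<subseteq> {..<a}" "T \<subseteq> {..<b}"
    then have "cross_mat a b S {} + cross_mat a b {} T \<in> code0 a b"
      by (intro add rows cols) (auto intro: finite_subset)
    then show "cross_mat a b S T \<in> code0 a b"
      by (simp add: cross_mat_add)
  qed
qed

text \<open>The generators are the crosses \<open>({i}, {j})\<close>, which are even. Conversely, build up an
  even cross one row or column at a time. The intermediate crosses may be odd; row \<open>0\<close> serves as a
  correction: adding it exactly when the cross is odd keeps the corrected cross inside the code, since
  each step then adds rows \<open>i\<close> and \<open>0\<close>, a sum of two generators, or row \<open>0\<close> and column \<open>j\<close>, a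
  generator.\<close>

lemma code1_eq:
  assumes "1 \<le> a" "1 \<le> b"
  shows "code1 a b = (\<lambda>(S, T). cross_mat a b S T) ` even_pairs a b"
proof
  interpret matrix_vs a b "TYPE(bit)" .
  let ?G = "{row_mat a b i + col_mat a b j | i j. i < a \<and> j < b}"
  have G_eq: "?G = {cross_mat a b {i} {j} | i j. i < a \<and> j < b}"
    by (simp add: row_mat_eq_cross_mat col_mat_eq_cross_mat cross_mat_add)
  then have G: "?G \<subseteq> carrier_mat a b" by auto
  have "?G \<subseteq> (\<lambda>(S, T). cross_mat a b S T) ` even_pairs a b"
    unfolding G_eq by (force simp: even_pairs_def)
  then show "code1 a b \<subseteq> (\<lambda>(S, T). cross_mat a b S T) ` even_pairs a b"
    unfolding code1_def by (rule span_is_subset[OF _ submodule_even_crosses])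
  have sub: "submodule class_ring (code1 a b) V"
    unfolding code1_def using G by (rule span_is_submodule)
  have add: "cross_mat a b (sym_diff S S') (sym_diff T T') \<in> code1 a b"
    if "cross_mat a b S T \<in> code1 a b" "cross_mat a b S' T' \<in> code1 a b" for S T S' T'
    using submodule.m_closed[OF sub that] by (simp add: matrix_vs_simps cross_mat_add)
  have gen: "cross_mat a b {i} {j} \<in> code1 a b" if "i < a" "j < b" for i j
  proof -
    have "cross_mat a b {i} {j} \<in> ?G"
      unfolding G_eq using that by blast
    moreover have "?G \<subseteq> code1 a b"
      unfolding code1_def using G by (rule in_own_span)
    ultimately show ?thesis by (rule rev_subsetD)
  qed
  define parity_row :: "nat set \<Rightarrow> nat set" where
    "parity_row X = (if even (card X) then {} else {0})" for X
  have empty: "cross_mat a b {} {} \<in> code1 a b"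
    using submodule.zero_closed[OF sub] by (simp add: matrix_vs_simps cross_mat_empty)
  have rows: "cross_mat a b (sym_diff S (parity_row S)) {} \<in> code1 a b"
    if "finite S" "S \<subseteq> {..<a}" for S
    using that
  proof (induction S rule: finite_induct)
    case (insert i S)
    have "cross_mat a b {i} {0} \<in> code1 a b" "cross_mat a b {0} {0} \<in> code1 a b"
      using gen[of i 0] gen[of 0 0] insert.prems assms by auto
    \<comment> \<open>The column common to both generators cancels.\<close>
    from add[OF this] have "cross_mat a b (sym_diff {i} {0}) {} \<in> code1 a b"
      by simp
    moreover have "cross_mat a b (sym_diff S (parity_row S)) {} \<in> code1 a b"
      using insert by simp
    ultimately have "cross_mat a b (sym_diff (sym_diff {i} {0}) (sym_diff S (parity_row S)))
        (sym_diff {} {}) \<in> code1 a b"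
      by (rule add)
    moreover have "sym_diff (sym_diff {i} {0}) (sym_diff S (parity_row S)) =
        sym_diff (insert i S) (parity_row (insert i S))"
    proof (cases "even (card S)")
      case True
      then have "parity_row S = {}" "parity_row (insert i S) = {0}"
        using insert.hyps by (simp_all add: parity_row_def)
      then show ?thesis using insert.hyps(2) by blast
    next
      case False
      then have "parity_row S = {0}" "parity_row (insert i S) = {}"
        using insert.hyps by (simp_all add: parity_row_def)
      then show ?thesis using insert.hyps(2) by blast
    qed
    ultimately show ?case by simp
  qed (simp add: parity_row_def empty)
  have cols: "cross_mat a b (parity_row T) T \<in> code1 a b" if "finite T" "T \<subseteq> {..<b}" for T
    using that
  proof (induction T rule: finite_induct)
    case (insert j T)
    have "cross_mat a b {0} {j} \<in> code1 a b"
      using gen[of 0 j] insert.prems assms by auto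
    moreover have "cross_mat a b (parity_row T) T \<in> code1 a b"
      using insert by simp
    ultimately have "cross_mat a b (sym_diff {0} (parity_row T)) (sym_diff {j} T) \<in> code1 a b"
      by (rule add)
    moreover have "sym_diff {0} (parity_row T) = parity_row (insert j T)"
      using insert.hyps by (simp add: parity_row_def)
    moreover have "sym_diff {j} T = insert j T"
      using insert.hyps by blast
    ultimately show ?case by simp
  qed (simp add: parity_row_def empty)
  show "(\<lambda>(S, T). cross_mat a b S T) ` even_pairs a b \<subseteq> code1 a b"
  proof clarify
    fix S T assume ST: "(S, T) \<in> even_pairs a b"
    then have "S \<subseteq> {..<a}" "T \<subseteq> {..<b}" by (auto simp: even_pairs_def)
    then have "cross_mat a b (sym_diff (sym_diff S (parity_row S)) (parity_row T)) (sym_diff {} T) \<in> code1 a b"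
      using add[OF rows cols] finite_subset by blast
    \<comment> \<open>The corrections of the two halves agree for an even pair, hence cancel.\<close>
    moreover have "parity_row S = parity_row T"
      using ST by (auto simp: even_pairs_def parity_row_def)
    then have "sym_diff (sym_diff S (parity_row S)) (parity_row T) = S" by auto
    ultimately show "cross_mat a b S T \<in> code1 a b" by simp
  qed
qed

section \<open>Counting codewords\<close>

text \<open>As row \<open>0\<close> is not selected, row \<open>0\<close> of the matrix is the indicator of \<open>T\<close>; any entry of
  row \<open>i\<close> then tells whether \<open>i \<in> S\<close>.\<close>

lemma inj_on_cross_mat:
  assumes "1 \<le> a" "1 \<le> b"
  shows "inj_on (\<lambda>(S, T). cross_mat a b S T) (Pow {1..<a} \<times> Pow {..<b})"
proof (rule inj_onI, clarify)
  fix S T S' T'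
  assume S: "S \<subseteq> {1..<a}" "S' \<subseteq> {1..<a}" and T: "T \<subseteq> {..<b}" "T' \<subseteq> {..<b}"
    and eq: "cross_mat a b S T = cross_mat a b S' T'"
  have entry: "((i \<in> S) \<noteq> (j \<in> T)) = ((i \<in> S') \<noteq> (j \<in> T'))" if "i < a" "j < b" for i j
    using arg_cong[OF eq, of "\<lambda>v. v $$ (i, j)"] that by (simp add: of_bool_eq_iff)
  have T_eq: "j \<in> T \<longleftrightarrow> j \<in> T'" if "j < b" for j
    using entry[of 0 j] S assms that by fastforce
  have S_eq: "i \<in> S \<longleftrightarrow> i \<in> S'" if "i < a" for i
    using entry[of i 0] T_eq[of 0] assms that by auto
  have "S = S'" using S S_eq by fastforce
  moreover have "T = T'" using T T_eq by fastforce
  ultimately show "S = S' \<and> T = T'" by simp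
qed

lemma finite_cross_pairs: "P \<subseteq> cross_pairs a b \<Longrightarrow> finite P"
  by (rule finite_subset[of _ "cross_pairs a b"]) auto

lemma card_complement:
  assumes "S \<subseteq> {..<n}"
  shows "card ({..<n} - S) = n - card S" "card S \<le> n"
  using assms card_Diff_subset[of S "{..<n}"] card_mono[of "{..<n}" S]
  by (auto intro: finite_subset)

text \<open>Each cross comes from two complementary pairs, of which exactly one leaves out row \<open>0\<close>.\<close>

lemma card_cross_mat_image:
  assumes "1 \<le> a" "1 \<le> b" "P \<subseteq> cross_pairs a b"
    and complement: "\<And>S T. (S, T) \<in> P \<Longrightarrow> ({..<a} - S, {..<b} - T) \<in> P"
  shows "card ((\<lambda>(S, T). cross_mat a b S T) ` P) = card {(S, T) \<in> P. 0 \<notin> S}"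
proof -
  let ?Q = "{(S, T) \<in> P. 0 \<notin> S}"
  have "(\<lambda>(S, T). cross_mat a b S T) ` P = (\<lambda>(S, T). cross_mat a b S T) ` ?Q"
  proof
    show "(\<lambda>(S, T). cross_mat a b S T) ` P \<subseteq> (\<lambda>(S, T). cross_mat a b S T) ` ?Q"
    proof clarify
      fix S T assume ST: "(S, T) \<in> P"
      show "cross_mat a b S T \<in> (\<lambda>(S, T). cross_mat a b S T) ` ?Q"
      proof (cases "0 \<in> S")
        case True
        then have "({..<a} - S, {..<b} - T) \<in> ?Q"
          using complement[OF ST] by simp
        then show ?thesis
          by (rule rev_image_eqI) (simp add: cross_mat_complement)
      next
        case False
        then have "(S, T) \<in> ?Q" using ST by simp
        then show ?thesis by (rule rev_image_eqI) simp
      qed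
    qed
  qed auto
  moreover have "?Q \<subseteq> Pow {1..<a} \<times> Pow {..<b}"
  proof clarify
    fix S T assume ST: "(S, T) \<in> P" "0 \<notin> S"
    then have "S \<subseteq> {..<a}" "T \<subseteq> {..<b}" using assms(3) by auto
    moreover have "1 \<le> i" if "i \<in> S" for i
      using that ST(2) by (cases i) auto
    ultimately show "S \<in> Pow {1..<a} \<and> T \<in> Pow {..<b}" by auto
  qed
  then have "inj_on (\<lambda>(S, T). cross_mat a b S T) ?Q"
    by (rule inj_on_subset[OF inj_on_cross_mat[OF assms(1,2)]])
  ultimately show ?thesis
    by (simp add: card_image)
qed

lemma card_code0:
  assumes "1 \<le> a" "1 \<le> b"
  shows "card (code0 a b) = 2 ^ (a + b - 1)"
proof -
  have "{(S, T) \<in> cross_pairs a b. 0 \<notin> S} = Pow {1..<a} \<times> Pow {..<b}"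
    by (auto simp: subset_iff Suc_le_eq intro!: gr0I)
  then have "card (code0 a b) = card (Pow {1..<a} \<times> Pow {..<b})"
    using card_cross_mat_image[OF assms, of "cross_pairs a b"] by (simp add: code0_eq)
  also have "\<dots> = 2 ^ (a - 1 + b)"
    by (simp add: card_cartesian_product card_Pow power_add)
  finally show ?thesis
    using assms by simp
qed

lemma card_code1:
  assumes "1 \<le> a" "1 \<le> b" "even (a + b)"
  shows "card (code1 a b) = 2 ^ (a + b - 2)"
proof -
  have "({..<a} - S, {..<b} - T) \<in> even_pairs a b" if "(S, T) \<in> even_pairs a b" for S T
  proof -
    have "S \<subseteq> {..<a}" "T \<subseteq> {..<b}" "even (card S + card T)"
      using that by (auto simp: even_pairs_def)
    then show ?thesis
      using card_complement[of S a] card_complement[of T b] assms(3)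
      by (auto simp: even_pairs_def)
  qed
  then have "card (code1 a b) = card {(S, T) \<in> even_pairs a b. 0 \<notin> S}"
    using card_cross_mat_image[OF assms(1,2), of "even_pairs a b"]
    by (auto simp: code1_eq[OF assms(1,2)] even_pairs_def)
  also have "\<dots> = card (Pow {1..<a} \<times> Pow {1..<b})"
  proof (rule bij_betw_same_card)
    let ?Q = "{(S, T) \<in> even_pairs a b. 0 \<notin> S}"
    \<comment> \<open>Among normalised even pairs, membership of column \<open>0\<close> in \<open>T\<close> is a parity bit, determined by the rest.\<close>
    define f :: "nat set \<times> nat set \<Rightarrow> nat set \<times> nat set" where
      "f = (\<lambda>(S, T). (S, T - {0}))"
    define g :: "nat set \<times> nat set \<Rightarrow> nat set \<times> nat set" where
      "g = (\<lambda>(S, T). (S, if even (card S + card T) then T else insert 0 T))"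
    have no_zero: "X \<subseteq> {1..<n} \<longleftrightarrow> X \<subseteq> {..<n} \<and> 0 \<notin> X" for X :: "nat set" and n
      by (auto simp: subset_iff Suc_le_eq intro!: gr0I)
    show "bij_betw f ?Q (Pow {1..<a} \<times> Pow {1..<b})"
    proof (rule bij_betw_byWitness[where f' = g])
      show "\<forall>x\<in>?Q. g (f x) = x"
      proof clarify
        fix S T assume ST: "(S, T) \<in> even_pairs a b" "0 \<notin> S"
        then have T: "finite T" "even (card S + card T)"
          by (auto simp: even_pairs_def intro: finite_subset)
        show "g (f (S, T)) = (S, T)"
        proof (cases "0 \<in> T")
          case True
          then have "odd (card S + card (T - {0}))"
            using T card_Suc_Diff1[of T 0] by presburger
          then show ?thesis
            using True
            by (simp only: f_def g_def case_prod_conv if_False insert_Diff_single insert_absorb)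
        next
          case False
          then show ?thesis
            using T by (simp add: f_def g_def)
        qed
      qed
      show "\<forall>x\<in>Pow {1..<a} \<times> Pow {1..<b}. f (g x) = x"
        by (auto simp: f_def g_def)
      show "f ` ?Q \<subseteq> Pow {1..<a} \<times> Pow {1..<b}"
        unfolding no_zero Pow_def by (auto simp: f_def even_pairs_def)
      show "g ` (Pow {1..<a} \<times> Pow {1..<b}) \<subseteq> ?Q"
      proof clarify
        fix S T S' T' assume ST: "S \<subseteq> {1..<a}" "T \<subseteq> {1..<b}" and g: "(S', T') = g (S, T)"
        then have "finite T" "0 \<notin> T" by (auto intro: finite_subset)
        then have "even (card S' + card T')"
          using g by (auto simp: g_def split: if_splits)
        moreover have "S' \<subseteq> {..<a}" "T' \<subseteq> {..<b}" "0 \<notin> S'"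
          using ST g assms unfolding no_zero by (auto simp: g_def split: if_splits)
        ultimately show "(S', T') \<in> even_pairs a b \<and> 0 \<notin> S'"
          by (simp add: even_pairs_def)
      qed
    qed
  qed
  also have "\<dots> = 2 ^ (a - 1 + (b - 1))"
    by (simp add: card_cartesian_product card_Pow power_add)
  also have "a - 1 + (b - 1) = a + b - 2"
    using assms by simp
  finally show ?thesis .
qed

section \<open>Minimum distance\<close>

text \<open>The four numbers are the sizes of \<open>S\<close>, its complement, \<open>T\<close> and its complement. The non-vanishing
  hypotheses exclude the two pairs that represent the zero matrix.\<close>

lemma even_cross_weight_bound:
  fixes s s' t t' :: nat
  assumes le: "s + s' \<le> t + t'" and even: "even (s + t)" "even (s' + t')"
    and nonzero: "s \<noteq> 0 \<or> t \<noteq> 0" "s' \<noteq> 0 \<or> t' \<noteq> 0"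
  shows "(if s + s' < t + t' then 2 * (s + s') else 2 * (s + s') - 2) \<le> s * t' + s' * t"
proof -
  have two_le: "2 \<le> n" if "even n" "n \<noteq> 0" for n :: nat
    using that by presburger
  consider "s = 0" | "s' = 0" | "t = 0" | "t' = 0"
    | "1 \<le> s" "1 \<le> s'" "1 \<le> t" "1 \<le> t'" by linarith
  then show ?thesis
  proof cases
    case 1
    then have "2 \<le> t" using two_le even nonzero by simp
    then obtain k where "t = 2 + k" using le_Suc_ex by blast
    then have "2 * (s + s') \<le> s * t' + s' * t" using 1 by (simp add: algebra_simps)
    then show ?thesis by (rule order_trans[rotated]) simp
  next
    case 2
    then have "2 \<le> t'" using two_le even nonzero by simp
    then obtain k where "t' = 2 + k" using le_Suc_ex by blast
    then have "2 * (s + s') \<le> s * t' + s' * t" using 2 by (simp add: algebra_simps)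
    then show ?thesis by (rule order_trans[rotated]) simp
  next
    case 3
    then have "2 \<le> s" using two_le even nonzero by simp
    then obtain k where "s = 2 + k" using le_Suc_ex by blast
    then have "2 * (s + s') \<le> s * t' + s' * t" using 3 le by (simp add: algebra_simps)
    then show ?thesis by (rule order_trans[rotated]) simp
  next
    case 4
    then have "2 \<le> s'" using two_le even nonzero by simp
    then obtain k where "s' = 2 + k" using le_Suc_ex by blast
    then have "2 * (s + s') \<le> s * t' + s' * t" using 4 le by (simp add: algebra_simps)
    then show ?thesis by (rule order_trans[rotated]) simp
  next
    case 5
    \<comment> \<open>This is \<open>(m - 1) (n - 1) \<ge> 0\<close> without subtraction.\<close>
    have sum_le: "m + n \<le> m * n + 1" if "1 \<le> m" "1 \<le> n" for m n :: nat
      using that by (cases m; cases n) auto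
    define w where "w = s * t' + s' * t"
    have "s + t' \<le> s * t' + 1" "s' + t \<le> s' * t + 1"
      using sum_le 5 by blast+
    then have "(s + t') + (s' + t) \<le> (s * t' + 1) + (s' * t + 1)"
      by (rule add_mono)
    then have bound: "s + s' + (t + t') \<le> w + 2"
      by (simp add: w_def)
    show ?thesis
    proof (cases "s + s' < t + t'")
      case True
      then have "s + s' + 2 \<le> t + t'" using even by presburger
      then have "2 * (s + s') \<le> w" using bound by simp
      then show ?thesis using True by (simp only: w_def if_True)
    next
      case False
      have "2 * (s + s') - 2 \<le> w" using bound le by simp
      then show ?thesis using False by (simp only: w_def if_False)
    qed
  qed
qed

text \<open>The bound is attained by the sum of columns \<open>0\<close> and \<open>1\<close> if \<open>a < b\<close>, and by the sum of row \<open>0\<close> and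
  column \<open>0\<close> if \<open>a = b\<close>. The assumption \<open>1 < b\<close> leaves out the zero code, which has no minimum
  distance.\<close>

lemma min_distance_code1:
  assumes "1 \<le> a" "a \<le> b" "even (a + b)" "1 < b"
  shows "min_distance a b (code1 a b) = (if a < b then 2 * a else 2 * a - 2)"
  unfolding min_distance_def
proof (rule Min_eqI)
  have b: "1 \<le> b" using assms by simp
  note code1 = code1_eq[OF assms(1) b]
  show "finite (weight ` (code1 a b - {0\<^sub>m a b}))"
    unfolding code1
    by (intro finite_imageI finite_Diff finite_cross_pairs) (auto simp: even_pairs_def)
  fix w assume "w \<in> weight ` (code1 a b - {0\<^sub>m a b})"
  then obtain S T where ST: "S \<subseteq> {..<a}" "T \<subseteq> {..<b}" "even (card S + card T)"
    and nonzero: "cross_mat a b S T \<noteq> 0\<^sub>m a b" and w: "w = weight (cross_mat a b S T)"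
    by (auto simp: code1 even_pairs_def)
  have fin: "finite S" "finite T" using ST finite_subset by blast+
  have le: "card S \<le> a" "card T \<le> b" using ST by (simp_all add: card_complement)
  have "card S \<noteq> 0 \<or> card T \<noteq> 0"
    using nonzero fin by (auto simp: cross_mat_empty)
  moreover have "a - card S \<noteq> 0 \<or> b - card T \<noteq> 0"
  proof (rule ccontr)
    assume "\<not> ?thesis"
    then have "card S = a" "card T = b" using le by simp_all
    then have "S = {..<a}" "T = {..<b}"
      using card_subset_eq[OF _ ST(1)] card_subset_eq[OF _ ST(2)] by simp_all
    then have "cross_mat a b S T = cross_mat a b {} {}"
      using cross_mat_complement[of a b "{}" "{}"] by simp
    then show False using nonzero by (simp add: cross_mat_empty)
  qed
  ultimately show "(if a < b then 2 * a else 2 * a - 2) \<le> w"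
  proof -
    assume "card S \<noteq> 0 \<or> card T \<noteq> 0" "a - card S \<noteq> 0 \<or> b - card T \<noteq> 0"
    moreover have sums: "card S + (a - card S) = a" "card T + (b - card T) = b"
      using le by simp_all
    moreover have "even ((a - card S) + (b - card T))"
      using le ST(3) assms(3) by simp
    ultimately have "(if a < b then 2 * a else 2 * a - 2)
        \<le> card S * (b - card T) + (a - card S) * card T"
      using even_cross_weight_bound[of "card S" "a - card S" "card T" "b - card T"] ST(3) assms(2)
      by (simp only: sums)
    then show ?thesis
      by (simp only: w weight_cross_mat[OF ST(1,2)])
  qed
next
  have b: "1 \<le> b" using assms by simp
  note code1 = code1_eq[OF assms(1) b]
  have zero: "weight (0\<^sub>m a b) = 0"
    using weight_cross_mat[of "{}" a "{}" b] by (simp add: cross_mat_empty)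
  have attained: "w \<in> weight ` (code1 a b - {0\<^sub>m a b})"
    if "(S, T) \<in> even_pairs a b" "weight (cross_mat a b S T) = w" "w \<noteq> 0" for S T w
  proof -
    have "cross_mat a b S T \<in> code1 a b"
      unfolding code1 using that(1) by (rule rev_image_eqI) simp
    moreover have "cross_mat a b S T \<noteq> 0\<^sub>m a b"
      using that(2,3) zero by metis
    ultimately show ?thesis using that(2) by blast
  qed
  show "(if a < b then 2 * a else 2 * a - 2) \<in> weight ` (code1 a b - {0\<^sub>m a b})"
  proof (cases "a < b")
    case True
    have "weight (cross_mat a b {} {0, 1}) = 2 * a"
      using weight_cross_mat[of "{}" a "{0, 1}" b] assms by simp
    moreover have "({}, {0, 1}) \<in> even_pairs a b"
      using assms by (simp add: even_pairs_def)
    ultimately show ?thesis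
      using attained[of "{}" "{0, 1}"] True assms(1) by simp
  next
    case False
    then have "b = a" using assms(2) by simp
    moreover from this have "weight (cross_mat a b {0} {0}) = 2 * a - 2"
      using weight_cross_mat[of "{0}" a "{0}" b] assms by simp
    moreover have "({0}, {0}) \<in> even_pairs a b"
      using assms by (simp add: even_pairs_def)
    ultimately show ?thesis
      using attained[of "{0}" "{0}"] assms(4) by simp
  qed
qed

section \<open>Special cases\<close>

lemma code1_1_1: "code1 1 1 = {0\<^sub>m 1 1}"
proof -
  have "0\<^sub>m 1 1 \<in> code1 1 1"
    using cross_mat_empty[of 1 1] by (force simp: code1_eq even_pairs_def)
  moreover have "card (code1 1 1) = 1"
    using card_code1[of 1 1] by simp
  ultimately show ?thesis
    by (metis card_1_singletonE singletonD)
qed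

text \<open>The four matrices are crosses of even pairs and have distinct first rows, and the code has only
  four elements.\<close>

lemma code1_2_2:
  "code1 2 2 = {mat_of_rows_list 2 [[0, 0], [0, 0]], mat_of_rows_list 2 [[0, 1], [1, 0]],
     mat_of_rows_list 2 [[1, 0], [0, 1]], mat_of_rows_list 2 [[1, 1], [1, 1]]}" (is "_ = ?M")
proof -
  have crosses:
    "mat_of_rows_list 2 [[0, 0], [0, 0]] = cross_mat 2 2 {} {}"
    "mat_of_rows_list 2 [[0, 1], [1, 0]] = cross_mat 2 2 {0} {0}"
    "mat_of_rows_list 2 [[1, 0], [0, 1]] = cross_mat 2 2 {0} {1}"
    "mat_of_rows_list 2 [[1, 1], [1, 1]] = cross_mat 2 2 {0, 1} {}"
    by (rule eq_matI; auto simp: mat_of_rows_list_def less_2_cases_iff)+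
  have mem: "cross_mat 2 2 S T \<in> code1 2 2" if "(S, T) \<in> even_pairs 2 2" for S T
    using that by (force simp: code1_eq)
  have sub: "?M \<subseteq> code1 2 2"
    unfolding crosses insert_subset
    by (intro conjI mem empty_subsetI) (auto simp: even_pairs_def)
  have card: "card (code1 2 2) = 4"
    using card_code1[of 2 2] by simp
  then have fin: "finite (code1 2 2)"
    using card_ge_0_finite by force
  let ?first_row = "\<lambda>v :: bit mat. (v $$ (0, 0), v $$ (0, 1))"
  have image: "?first_row ` ?M = {(0, 0), (0, 1), (1, 0), (1, 1)}"
    by (simp add: mat_of_rows_list_def)
  have four: "card ({(0, 0), (0, 1), (1, 0), (1, 1)} :: (bit \<times> bit) set) = 4"
    by simp
  have "card (?first_row ` ?M) \<le> card ?M"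
    by (rule card_image_le) simp
  then have "4 \<le> card ?M"
    unfolding image four .
  then show ?thesis
    using card_seteq[OF fin sub] card by simp
qed

text \<open>For odd \<open>a\<close> and \<open>b\<close> the weight \<open>s (b - t) + (a - s) t\<close> is congruent to \<open>s + t\<close> modulo 2.\<close>

lemma code1_eq_even_weight:
  assumes "odd a" "odd b"
  shows "code1 a b = {v \<in> code0 a b. even (weight v)}"
proof -
  have "1 \<le> a" "1 \<le> b"
    using assms by (auto elim: oddE)
  note codes = code0_eq code1_eq[OF this]
  have "even (weight (cross_mat a b S T)) \<longleftrightarrow> even (card S + card T)"
    if "S \<subseteq> {..<a}" "T \<subseteq> {..<b}" for S T
    using that assms card_complement(2)[OF that(1)] card_complement(2)[OF that(2)]
    by (auto simp: weight_cross_mat)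
  then show ?thesis
    by (auto simp: codes even_pairs_def)
qed

theorem proposition4p2:
  fixes a b :: nat
  assumes "1 \<le> a" and "a \<le> b" and "even (a + b)"
  shows "int (code_dim a b (code1 a b)) = int (code_dim a b (code0 a b)) - 1
    \<and> int (code_dim a b (code0 a b)) - 1 = int a + int b - 2
    \<and> (1 \<le> a \<and> a < b \<longrightarrow> min_distance a b (code1 a b) = 2 * a)
    \<and> (1 < a \<and> a = b \<longrightarrow> min_distance a b (code1 a b) = 2 * a - 2)
    \<and> (a = 1 \<and> b = 1 \<longrightarrow> code1 a b = {0\<^sub>m a b})
    \<and> (a = 2 \<and> b = 2 \<longrightarrow> code1 a b =
        {mat_of_rows_list 2 [[0, 0], [0, 0]], mat_of_rows_list 2 [[0, 1], [1, 0]],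
         mat_of_rows_list 2 [[1, 0], [0, 1]], mat_of_rows_list 2 [[1, 1], [1, 1]]})
    \<and> (odd a \<and> odd b \<longrightarrow> code1 a b = {v \<in> code0 a b. even (weight v)})"
proof -
  have b: "1 \<le> b" using assms by simp
  have "submodule class_ring (code0 a b) (mat_space a b)"
    unfolding code0_eq by (rule submodule_all_crosses)
  then have "code_dim a b (code0 a b) = a + b - 1"
    by (rule code_dim_eqI) (rule card_code0[OF assms(1) b])
  moreover have "submodule class_ring (code1 a b) (mat_space a b)"
    unfolding code1_eq[OF assms(1) b] by (rule submodule_even_crosses)
  then have "code_dim a b (code1 a b) = a + b - 2"
    by (rule code_dim_eqI) (rule card_code1[OF assms(1) b assms(3)])
  moreover have distance: "min_distance a b (code1 a b) = (if a < b then 2 * a else 2 * a - 2)"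
    if "1 < b"
    using assms that by (rule min_distance_code1)
  moreover have "min_distance a b (code1 a b) = 2 * a" if "1 \<le> a \<and> a < b"
    using distance that by simp
  moreover have "min_distance a b (code1 a b) = 2 * a - 2" if "1 < a \<and> a = b"
    using distance that by simp
  ultimately show ?thesis
    using assms(1) b code1_1_1 code1_2_2 code1_eq_even_weight[of a b]
    by (intro conjI impI) (simp_all add: of_nat_diff)
qed

end
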